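(* Let $s,t,m\in\mathbb{Z}$ be such that $s,t\ge 1$, $m<0$ and $0.06\le\{-2m\pi\}\le 0.99$. For any even integers $k_i,l_j\ge 50$ such that $k_i\neq l_j$ for every $1\le i\le s$, $1\le j\le t$, we have (as functions of $z$ on the upper half-plane $\mathbb{H}$) $$\prod_{i=1}^{s}G_{k_i}(z,m)\neq\prod_{j=1}^{t}G_{l_j}(z,m).$$
   Context: $\mathbb{H}=\{z\in\mathbb{C}:\Im(z)>0\}$. For a real number $x$, $\{x\}$ denotes its fractional part. For an even integer $k\ge 4$, $m\in\mathbb{Z}$ and $z\in\mathbb{H}$, the Poincaré series of weight $k$ and index $m$ for $\mathrm{SL}(2,\mathbb{Z})$ is $$G_k(z,m):=\frac12\sum_{\substack{c,d\in\mathbb{Z}\\ \gcd(c,d)=1}}\frac{e^{2\pi i m\gamma(z)}}{(cz+d)^k},$$ where for each pair $(c,d)$, $\gamma\in \mathrm{SL}(2,\mathbb{Z})$ is any matrix with second row $(c\ \ d)$, acting on $z$ by the Möbius transformation. *)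

theory Defs
  imports "HOL-Analysis.Analysis"
begin

definition upper_half_plane :: "complex set" where
  "upper_half_plane = {z. Im z > 0}"

definition SL2Z :: "(int ^ 2 ^ 2) set" where
  "SL2Z = {A. det A = 1}"

definition moebius_act :: "int ^ 2 ^ 2 \<Rightarrow> complex \<Rightarrow> complex" where
  "moebius_act A z =
     moebius (of_int (A $ 1 $ 1)) (of_int (A $ 1 $ 2)) (of_int (A $ 2 $ 1)) (of_int (A $ 2 $ 2)) z"

definition with_second_row :: "int \<Rightarrow> int \<Rightarrow> int ^ 2 ^ 2" where
  "with_second_row c d = (SOME A. A \<in> SL2Z \<and> A $ 2 $ 1 = c \<and> A $ 2 $ 2 = d)"

definition poincare_series :: "nat \<Rightarrow> complex \<Rightarrow> int \<Rightarrow> complex" where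
  "poincare_series k z m =
     1 / 2 * (\<Sum>\<^sub>\<infinity>(c, d)\<in>{(c, d). coprime c d}.
       exp (2 * of_real pi * \<i> * of_int m * moebius_act (with_second_row c d) z)
         / (of_int c * z + of_int d) ^ k)"

text \<open>
  The choice made in \<^const>\<open>with_second_row\<close> is possible for every coprime pair, and it is
  immaterial: any matrix of \<^const>\<open>SL2Z\<close> with the same second row gives the same summand.
\<close>

lemma with_second_row:
  assumes "coprime c d"
  shows "with_second_row c d \<in> SL2Z"
    and "with_second_row c d $ 2 $ 1 = c"
    and "with_second_row c d $ 2 $ 2 = d"
proof -
  obtain x y where xy: "x * c + y * d = 1"
    using assms bezout_int[of c d] by auto
  define A :: "int ^ 2 ^ 2" where "A = vector [vector [y, -x], vector [c, d]]"
  have "A \<in> SL2Z \<and> A $ 2 $ 1 = c \<and> A $ 2 $ 2 = d"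
    using xy by (simp add: A_def SL2Z_def det_2)
  then have "with_second_row c d \<in> SL2Z \<and> with_second_row c d $ 2 $ 1 = c
      \<and> with_second_row c d $ 2 $ 2 = d"
    unfolding with_second_row_def by (rule someI)
  then show "with_second_row c d \<in> SL2Z" "with_second_row c d $ 2 $ 1 = c"
    "with_second_row c d $ 2 $ 2 = d"
    by auto
qed

lemma exp_moebius_act_cong:
  assumes "A \<in> SL2Z" "B \<in> SL2Z"
    and row: "A $ 2 $ 1 = B $ 2 $ 1" "A $ 2 $ 2 = B $ 2 $ 2"
    and z: "z \<in> upper_half_plane"
  shows "exp (2 * of_real pi * \<i> * of_int m * moebius_act A z)
    = exp (2 * of_real pi * \<i> * of_int m * moebius_act B z)"
proof -
  define a b a' b' c d where defs: "a = A $ 1 $ 1" "b = A $ 1 $ 2" "a' = B $ 1 $ 1"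
    "b' = B $ 1 $ 2" "c = B $ 2 $ 1" "d = B $ 2 $ 2"
  have dets: "a * d - b * c = 1" "a' * d - b' * c = 1"
    using assms by (auto simp: SL2Z_def det_2 defs)
  define n where "n = a' * b - a * b'"
  have "a = a' + n * c" "b = b' + n * d"
    using dets unfolding n_def by algebra+
  then have ab: "of_int a = (of_int a' + of_int n * of_int c :: complex)"
    "of_int b = (of_int b' + of_int n * of_int d :: complex)"
    by simp_all
  have nz: "of_int c * z + of_int d \<noteq> 0"
  proof
    assume *: "of_int c * z + of_int d = 0"
    then have "Im (of_int c * z + of_int d) = 0"
      by simp
    with z have "c = 0"
      by (simp add: upper_half_plane_def)
    with * dets show False
      by simp
  qed
  have "moebius_act A z = moebius_act B z + of_int n"
    using nz unfolding moebius_act_def moebius_def row defs(1-6)[symmetric] ab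
    by (simp add: field_simps)
  then have "2 * of_real pi * \<i> * of_int m * moebius_act A z
      = 2 * of_real pi * \<i> * of_int m * moebius_act B z + of_int (2 * (m * n)) * of_real pi * \<i>"
    by (simp add: algebra_simps)
  then show ?thesis
    unfolding exp_eq by (intro exI[of _ "m * n"]) simp
qed

end

theory Submission
  imports Defs
begin

text \<open>
  Put \<open>K = - 2 \<pi> m > 0\<close>, \<open>n = k / 2\<close> and \<open>z = \<i> exp (\<i> t)\<close> with \<open>0 \<le> t \<le> 1/8\<close>. As in Rankin's work on
  zeros of Poincare series, the pairs \<open>(c, d)\<close> with \<open>c d = 0\<close> dominate: after multiplication by
  \<open>exp (- K cos t) z ^ n / 2\<close> the series becomes the real function
  \<open>cos (n \<pi> / 2 + n t + K sin t)\<close> plus a real remainder that is tiny, has a tiny Lipschitz constant,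
  and vanishes at \<open>t = 0\<close> for odd \<open>n\<close> (by the symmetry \<open>z \<mapsto> - 1 / z\<close>). Hence the smallest positive
  zero occurs where the phase \<open>n t + K sin t\<close> is very close to \<open>\<pi> / 2\<close> (\<open>n\<close> even) or \<open>\<pi>\<close> (\<open>n\<close> odd).

  Two distinct weights cannot share such a first zero. For the same parity the phases differ by
  at least \<open>t\<close>. If \<open>a\<close> is even and \<open>b\<close> odd, subtracting twice the phase of \<open>a\<close> from that of \<open>b\<close>
  shows that the integer \<open>b - 2 a\<close> is close to \<open>K sin t / t\<close>, hence to \<open>K\<close>, against the hypothesis on
  the fractional part of \<open>K\<close>. So at the smallest of all first zeros exactly one weight vanishes,
  and it occurs on one side of the supposed identity only.
\<close>

subsection \<open>The sum over the remaining lattice points\<close>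

lemma has_sum_inverse_squares_nonzero_int:
  "((\<lambda>c::int. 1 / (of_int c)\<^sup>2 :: real) has_sum pi\<^sup>2 / 3) (- {0})"
proof -
  let ?f = "\<lambda>c::int. 1 / (of_int c)\<^sup>2 :: real"
  have "summable (\<lambda>n. norm (1 / (real n + 1)\<^sup>2))"
    using inverse_squares_sums by (simp add: sums_iff add.commute)
  then have "((\<lambda>n. 1 / (real n + 1)\<^sup>2) has_sum pi\<^sup>2 / 6) UNIV"
    using inverse_squares_sums by (intro norm_summable_imp_has_sum) (simp_all add: add.commute)
  then have nat_sum: "((\<lambda>n. ?f (int n + 1)) has_sum pi\<^sup>2 / 6) UNIV"
    by simp
  have pos: "(?f has_sum pi\<^sup>2 / 6) {0<..}"
    using nat_sum
    by (subst (asm) has_sum_reindex_bij_witness[where j = "\<lambda>n. int n + 1" and i = "\<lambda>c. nat (c - 1)"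
          and T = "{0<..}" and h = ?f]) auto
  have neg: "(?f has_sum pi\<^sup>2 / 6) {..<0}"
    using pos
    by (subst (asm) has_sum_reindex_bij_witness[where j = uminus and i = uminus
          and T = "{..<0}" and h = ?f]) auto
  have "(?f has_sum (pi\<^sup>2 / 6 + pi\<^sup>2 / 6)) ({0<..} \<union> {..<0})"
    by (intro has_sum_Un_disjoint pos neg) auto
  moreover have "{0<..} \<union> {..<0} = - {0::int}" by auto
  ultimately show ?thesis by simp
qed

text \<open>The product of two copies of the one-variable sum. It later majorises the sum over all
  coprime pairs with \<open>c d \<noteq> 0\<close>.\<close>

lemma has_sum_inverse_squares_nonzero_int_pairs:
  "((\<lambda>(c, d). 1 / ((of_int c)\<^sup>2 * (of_int d)\<^sup>2) :: real) has_sum (pi\<^sup>2 / 3)\<^sup>2) ((- {0::int}) \<times> (- {0::int}))"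
proof -
  have inner: "((\<lambda>d. 1 / ((of_int c)\<^sup>2 * (of_int d)\<^sup>2) :: real) has_sum (1 / (of_int c)\<^sup>2 * (pi\<^sup>2 / 3))) (- {0::int})"
    for c :: int
    using has_sum_cmult_right[OF has_sum_inverse_squares_nonzero_int, of "1 / (of_int c)\<^sup>2"] by simp
  have outer: "((\<lambda>c::int. 1 / (of_int c)\<^sup>2 * (pi\<^sup>2 / 3) :: real) has_sum (pi\<^sup>2 / 3)\<^sup>2) (- {0})"
    using has_sum_cmult_left[OF has_sum_inverse_squares_nonzero_int, of "pi\<^sup>2 / 3"]
    by (simp add: power2_eq_square)
  show ?thesis
  proof (rule has_sum_SigmaI)
    show "((\<lambda>d. (\<lambda>(c, d). 1 / ((of_int c)\<^sup>2 * (of_int d)\<^sup>2) :: real) (c, d)) has_sum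
      (1 / (of_int c)\<^sup>2 * (pi\<^sup>2 / 3))) (- {0::int})" for c :: int
      using inner by simp
    show "((\<lambda>c::int. 1 / (of_int c)\<^sup>2 * (pi\<^sup>2 / 3) :: real) has_sum (pi\<^sup>2 / 3)\<^sup>2) (- {0})"
      by (rule outer)
    show "(\<lambda>(c, d). 1 / ((of_int c)\<^sup>2 * (of_int d)\<^sup>2) :: real) summable_on ((- {0::int}) \<times> (- {0::int}))"
      by (rule summable_on_SigmaI[where g = "\<lambda>c. 1 / (of_int c)\<^sup>2 * (pi\<^sup>2 / 3)"])
        (use inner outer in \<open>auto simp: summable_on_def\<close>)
  qed
qed

section \<open>Summands of the series and the choice of the matrix\<close>

definition poincare_term :: "nat \<Rightarrow> int \<Rightarrow> complex \<Rightarrow> int \<times> int \<Rightarrow> complex" where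
  "poincare_term k m z = (\<lambda>(c, d).
     exp (2 * of_real pi * \<i> * of_int m * moebius_act (with_second_row c d) z)
       / (of_int c * z + of_int d) ^ k)"

lemma poincare_series_altdef:
  "poincare_series k z m = 1 / 2 * infsum (poincare_term k m z) {(c, d). coprime c d}"
  by (simp add: poincare_series_def poincare_term_def)

text \<open>The first row picked by \<open>with_second_row\<close> is unknown but immaterial. Here
  it is exchanged for any convenient one, so that symmetries of the series can be read off from
  explicit matrices.\<close>

lemma poincare_term_eq:
  fixes a b c d :: int
  assumes det: "a * d - b * c = 1" and z: "z \<in> upper_half_plane"
  shows "poincare_term k m z (c, d) =
    exp (2 * of_real pi * \<i> * of_int m * ((of_int a * z + of_int b) / (of_int c * z + of_int d)))
      / (of_int c * z + of_int d) ^ k"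
proof -
  define A :: "int ^ 2 ^ 2" where "A = vector [vector [a, b], vector [c, d]]"
  have A: "A \<in> SL2Z" and A_entries: "A $ 1 $ 1 = a" "A $ 1 $ 2 = b" "A $ 2 $ 1 = c" "A $ 2 $ 2 = d"
    using det by (simp_all add: A_def SL2Z_def det_2)
  have "coprime c d"
    using det by (intro coprimeI) (metis dvd_diff dvd_mult)
  then have "exp (2 * of_real pi * \<i> * of_int m * moebius_act (with_second_row c d) z)
    = exp (2 * of_real pi * \<i> * of_int m * moebius_act A z)"
    using A A_entries z with_second_row by (intro exp_moebius_act_cong) simp_all
  then show ?thesis
    by (simp add: poincare_term_def moebius_act_def moebius_def A_entries)
qed

lemma coprime_imp_det_one:
  fixes c d :: int
  assumes "coprime c d"
  obtains a b where "a * d - b * c = 1"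
proof -
  obtain x y where "x * c + y * d = 1"
    using assms bezout_int[of c d] by auto
  then show thesis
    by (intro that[of y "- x"]) simp
qed

section \<open>Estimates for single summands on the unit arc starting at \<open>\<i>\<close>\<close>

definition unit_arc :: "real \<Rightarrow> complex" where
  "unit_arc t = \<i> * cis t"

lemma Re_unit_arc [simp]: "Re (unit_arc t) = - sin t" and Im_unit_arc [simp]: "Im (unit_arc t) = cos t"
  by (simp_all add: unit_arc_def)

lemma norm_unit_arc [simp]: "norm (unit_arc t) = 1"
  by (simp add: unit_arc_def norm_mult)

lemma unit_arc_nonzero [simp]: "unit_arc t \<noteq> 0"
  using norm_unit_arc[of t] by fastforce

lemma cis_unit_arc: "cis (pi / 2 + t) = unit_arc t"
  by (simp add: unit_arc_def cis_mult[symmetric])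

lemma cnj_unit_arc: "cnj (unit_arc t) = 1 / unit_arc t"
  using complex_div_cnj[of 1 "unit_arc t"] by simp

lemma sin_cos_bounds:
  fixes t :: real
  assumes "0 \<le> t" "t \<le> 1 / 8"
  shows "0 \<le> sin t" "sin t \<le> 1 / 8" "(99 / 100) \<le> cos t"
proof -
  show "0 \<le> sin t" using assms pi_gt3 by (intro sin_ge_zero) linarith+
  show s: "sin t \<le> 1 / 8" using sin_x_le_x[of t] assms by linarith
  have "(sin (t / 2))\<^sup>2 \<le> (1 / 16)\<^sup>2"
    using abs_sin_x_le_abs_x[of "t / 2"] assms by (subst abs_le_square_iff[symmetric]) linarith
  moreover have "cos t = 1 - 2 * (sin (t / 2))\<^sup>2"
    using cos_double_sin[of "t / 2"] by simp
  ultimately show "(99 / 100) \<le> cos t" by (simp add: power2_eq_square)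
qed

lemma unit_arc_in_upper_half_plane:
  "0 \<le> t \<Longrightarrow> t \<le> 1 / 8 \<Longrightarrow> unit_arc t \<in> upper_half_plane"
  using sin_cos_bounds(3)[of t] by (simp add: upper_half_plane_def)

text \<open>The weight is \<open>2 * n\<close>; the power \<open>unit_arc t ^ n\<close> balances the
  automorphy factor, and the exponential cancels the modulus of the summand at
  \<open>(0, 1)\<close>. The factor \<open>1 / 4\<close> is the \<open>1 / 2\<close> of the series
  times another \<open>1 / 2\<close>, so that the four pairs with \<open>c d = 0\<close> add up to a
  cosine.\<close>

definition arc_term :: "nat \<Rightarrow> int \<Rightarrow> real \<Rightarrow> int \<times> int \<Rightarrow> complex" where
  "arc_term n m t p =
     exp (of_real (2 * pi * of_int m * cos t)) / 4 * unit_arc t ^ n * poincare_term (2 * n) m (unit_arc t) p"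

text \<open>On the unit circle the right-hand side is \<open>c^2 + d^2 - 2 c d sin t\<close>. Since
  \<open>c^2 + d^2 \<ge> 2 |c d|\<close> and \<open>sin t \<le> 1 / 8\<close>, a factor of
  \<open>2 - 1 / 4\<close> remains.\<close>

lemma norm_lattice_point_arc_ge:
  fixes c d :: int
  assumes "0 \<le> t" "t \<le> 1 / 8"
  shows "7 / 4 * \<bar>of_int c * of_int d\<bar> \<le> (norm (of_int c * unit_arc t + of_int d))\<^sup>2"
proof -
  define x y where "x = (of_int c :: real)" and "y = (of_int d :: real)"
  have "(norm (of_int c * unit_arc t + of_int d))\<^sup>2 = (y - x * sin t)\<^sup>2 + (x * cos t)\<^sup>2"
    by (simp add: cmod_power2 x_def y_def)
  also have "\<dots> = x\<^sup>2 + y\<^sup>2 - 2 * (x * y) * sin t"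
    using sin_cos_squared_add[of t] by algebra
  finally have eq: "(norm (of_int c * unit_arc t + of_int d))\<^sup>2 = x\<^sup>2 + y\<^sup>2 - 2 * (x * y) * sin t" .
  have "(x * y) * sin t \<le> \<bar>x * y\<bar> * sin t"
    using sin_cos_bounds[OF assms] by (intro mult_right_mono) auto
  moreover have "\<bar>x * y\<bar> * sin t \<le> \<bar>x * y\<bar> * (1 / 8)"
    using sin_cos_bounds[OF assms] by (intro mult_left_mono) auto
  moreover have "2 * \<bar>x * y\<bar> \<le> x\<^sup>2 + y\<^sup>2"
    using sum_squares_bound[of "\<bar>x\<bar>" "\<bar>y\<bar>"] by (simp add: abs_mult)
  ultimately show ?thesis
    unfolding eq x_def[symmetric] y_def[symmetric] by simp
qed

text \<open>With \<open>W = |c z + d|^2 \<ge> 7 / 4\<close>, the image of \<open>z\<close> has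
  imaginary part \<open>cos t / W \<le> 4 / 7 * cos t\<close>, so the normalisation by
  \<open>exp (- K cos t)\<close> leaves exponential decay in \<open>K\<close>. The denominator
  \<open>W ^ n\<close> gives decay in \<open>n\<close> and in \<open>c d\<close>. The Lipschitz
  bound follows from the mean value inequality and a bound on the logarithmic derivative.\<close>

lemma arc_term_bounds:
  fixes c d m :: int
  assumes n: "n \<ge> 2" and m: "m < 0" and cd: "coprime c d" "c \<noteq> 0" "d \<noteq> 0"
    and t: "0 \<le> t" "t \<le> 1 / 8" and s: "0 \<le> s" "s \<le> 1 / 8"
  defines "K \<equiv> - 2 * pi * of_int m"
  defines "B \<equiv> 1 / 4 * (4 / 7) ^ n * exp (- 21 / 50 * K) / ((of_int c)\<^sup>2 * (of_int d)\<^sup>2)"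
  shows "norm (arc_term n m t (c, d)) \<le> B"
    and "norm (arc_term n m t (c, d) - arc_term n m s (c, d)) \<le> (4 * real n + K) * B * \<bar>t - s\<bar>"
proof -
  obtain a b where det: "a * d - b * c = 1"
    using coprime_imp_det_one cd(1) by blast
  have K: "K > 0" using m by (simp add: K_def mult_pos_neg)
  \<comment> \<open>\<open>\<gamma>(z) = a / c - 1 / (c (c z + d))\<close> turns the summand into an explicit function of \<open>t\<close>.\<close>
  define w where "w = (\<lambda>\<tau>. of_int c * (\<i> * exp (\<i> * \<tau>)) + of_int d)"
  define h where "h = (\<lambda>\<tau>. - of_real K * cos \<tau> + \<i> * of_nat n * (of_real (pi / 2) + \<tau>)
     + \<i> * of_real K / (of_int c * w \<tau>))"
  define G where "G = (\<lambda>\<tau>. exp (h \<tau>) / w \<tau> ^ (2 * n))"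
  \<comment> \<open>The real shift \<open>a / c\<close> contributes only a constant phase;
    \<open>1 / 4\<close> is the factor in \<open>arc_term\<close>.\<close>
  define C where "C = exp (- \<i> * of_real (K * of_int a / of_int c)) / 4"
  have normC: "norm C = 1 / 4"
    by (simp add: C_def norm_divide)
  define r where "r = \<bar>of_int c * of_int d :: real\<bar>"
  have r1: "r \<ge> 1" 
  proof -
    have "\<bar>c * d\<bar> \<ge> 1" using cd by (simp add: abs_mult) (smt (verit) mult_le_cancel_left1)
    then show ?thesis unfolding r_def by (metis of_int_1_le_iff of_int_abs of_int_mult)
  qed
  have w_arc: "w (of_real u) = of_int c * unit_arc u + of_int d" for u
    by (simp add: w_def unit_arc_def cis_conv_exp)
  have w_sq: "(norm (w (of_real u)))\<^sup>2 \<ge> 7 / 4 * r" if "0 \<le> u" "u \<le> 1 / 8" for u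
    using norm_lattice_point_arc_ge[OF that, of c d] by (simp add: w_arc r_def)
  have w_sq': "(norm (w (of_real u)))\<^sup>2 \<ge> 7 / 4" if "0 \<le> u" "u \<le> 1 / 8" for u
    using w_sq[OF that] r1 by linarith
  have w_nz: "w (of_real u) \<noteq> 0" if "0 \<le> u" "u \<le> 1 / 8" for u
    using w_sq'[OF that] by auto
  have term_eq: "arc_term n m u (c, d) = C * G (of_real u)" if u: "0 \<le> u" "u \<le> 1 / 8" for u
  proof -
    have "(of_int a * unit_arc u + of_int b) / (of_int c * unit_arc u + of_int d)
       = of_int a / of_int c - 1 / (of_int c * w (of_real u))"
    proof -
      have "(of_int a * of_int d - of_int b * of_int c :: complex) = 1"
        using det by (metis of_int_1 of_int_diff of_int_mult)
      then show ?thesis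
        using w_nz[OF u] cd(2) unfolding w_arc
        by (simp add: divide_simps) (simp add: algebra_simps)
    qed
    then have "poincare_term (2 * n) m (unit_arc u) (c, d) =
      exp (- \<i> * of_real K * (of_int a / of_int c - 1 / (of_int c * w (of_real u)))) / w (of_real u) ^ (2 * n)"
      using poincare_term_eq[OF det unit_arc_in_upper_half_plane[OF u], of "2 * n" m]
      by (simp add: K_def w_arc mult_ac)
    moreover have "unit_arc u ^ n = exp (\<i> * of_nat n * (of_real (pi / 2) + of_real u))"
      unfolding cis_unit_arc[symmetric] cis_conv_exp exp_of_nat_mult[symmetric] by (simp add: algebra_simps)
    ultimately have "arc_term n m u (c, d) = exp (of_real (- K * cos u)) / 4
      * exp (\<i> * of_nat n * (of_real (pi / 2) + of_real u))
      * (exp (- \<i> * of_real K * (of_int a / of_int c - 1 / (of_int c * w (of_real u)))) / w (of_real u) ^ (2 * n))"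
      by (simp add: arc_term_def K_def)
    also have "\<dots> = C * G (of_real u)"
      unfolding C_def G_def h_def by (simp add: exp_add[symmetric] exp_diff[symmetric] algebra_simps cos_of_real)
    finally show ?thesis .
  qed
  have Im_w: "Im (of_int c * w (of_real u)) = (of_int c)\<^sup>2 * cos u" for u
    by (simp add: w_arc power2_eq_square)
  have G_bound: "norm (G (of_real u)) \<le> 4 * B" if u: "0 \<le> u" "u \<le> 1 / 8" for u
  proof -
    define W where "W = (norm (w (of_real u)))\<^sup>2"
    have W: "W \<ge> 7 / 4" "W \<ge> 7 / 4 * r" using w_sq'[OF u] w_sq[OF u] by (simp_all add: W_def)
    have "Re (\<i> * of_real K / (of_int c * w (of_real u))) = K * (cos u / W)"
    proof -
      have "Im (1 / (of_int c * w (of_real u))) = - ((of_int c)\<^sup>2 * cos u) / (norm (of_int c * w (of_real u)))\<^sup>2"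
        unfolding Im_w[symmetric] by (simp add: Im_divide cmod_power2 del: times_complex.sel)
      also have "\<dots> = - cos u / W"
        using cd(2) by (simp add: W_def norm_mult power_mult_distrib)
      finally show ?thesis by (simp add: divide_inverse mult.assoc)
    qed
    then have Re_h: "Re (h (of_real u)) = - K * cos u + K * (cos u / W)"
      by (simp add: h_def flip: cos_of_real)
    have "cos u / W \<le> cos u * (4 / 7)"
    proof -
      have "cos u / W \<le> cos u / (7 / 4)"
        using W sin_cos_bounds(3)[OF u] by (intro divide_left_mono) auto
      then show ?thesis by simp
    qed
    then have "K * (cos u / W) \<le> K * (cos u * (4 / 7))"
      using K by (intro mult_left_mono) auto
    also have "\<dots> = 4 / 7 * (K * cos u)" by simp
    finally have "K * (cos u / W) \<le> 4 / 7 * (K * cos u)" .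
    \<comment> \<open>The remaining exponent is at most \<open>- 3 / 7 * (99 / 100) * K\<close>, and
      \<open>3 / 7 * (99 / 100) > 21 / 50\<close>.\<close>
    moreover have "K * cos u \<ge> K * (99 / 100)"
      using K sin_cos_bounds(3)[OF u] by (intro mult_left_mono) auto
    ultimately have "Re (h (of_real u)) \<le> - 21 / 50 * K"
      unfolding Re_h using K by linarith
    then have e: "norm (exp (h (of_real u))) \<le> exp (- 21 / 50 * K)"
      by simp
    \<comment> \<open>Two of the \<open>n\<close> powers of \<open>r\<close> are kept, which is
      enough for summability over \<open>c\<close> and \<open>d\<close>.\<close>
    have "(7 / 4) ^ n * r\<^sup>2 \<le> (7 / 4 * r) ^ n"
      unfolding power_mult_distrib using r1 n by (intro mult_left_mono power_increasing) auto
    also have "\<dots> \<le> W ^ n"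
      using W r1 by (intro power_mono) auto
    also have "W ^ n = norm (w (of_real u) ^ (2 * n))"
      by (simp add: W_def norm_power power_mult)
    finally have "norm (G (of_real u)) \<le> exp (- 21 / 50 * K) / ((7 / 4) ^ n * r\<^sup>2)"
      unfolding G_def norm_divide using e r1 by (intro frac_le) auto
    also have "\<dots> = 4 * B"
      by (simp add: B_def r_def power_mult_distrib power_divide field_simps)
    finally show ?thesis .
  qed
  show "norm (arc_term n m t (c, d)) \<le> B"
    using G_bound[OF t] by (simp add: term_eq[OF t] norm_mult normC)
  define G' where "G' = (\<lambda>\<tau>. G \<tau> * (of_real K * sin \<tau> + \<i> * of_nat n + of_real K * (\<i> * exp (\<i> * \<tau>)) / (w \<tau>)\<^sup>2
     - 2 * of_nat n * (of_int c * (\<i> * (\<i> * exp (\<i> * \<tau>)))) / w \<tau>))"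
  \<comment> \<open>The parameter interval becomes a segment in the complex plane, where
    \<open>G\<close>, a function of a complex variable, can be differentiated.\<close>
  define S where "S = (of_real ` {0..1/8} :: complex set)"
  have "norm (G (of_real t) - G (of_real s)) \<le> ((4 * real n + K) * (4 * B)) * norm (of_real t - of_real s :: complex)"
  proof (rule field_differentiable_bound[where S = S and f' = G'])
    show "convex S"
      unfolding S_def by (intro convex_linear_image) (auto simp: linear_of_real)
    show "complex_of_real t \<in> S" "complex_of_real s \<in> S" using s t by (auto simp: S_def)
    show "(G has_field_derivative G' z) (at z within S)" if "z \<in> S" for z
    proof -
      from that obtain u where u: "z = of_real u" "0 \<le> u" "u \<le> 1 / 8" by (auto simp: S_def)
      have wz: "w z \<noteq> 0" using w_nz u by simp
      define w' where "w' = of_int c * (\<i> * (\<i> * exp (\<i> * z)))"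
      have dw: "(w has_field_derivative w') (at z within S)"
        unfolding w_def w'_def by (auto intro!: derivative_eq_intros simp: algebra_simps)
      have dh: "(h has_field_derivative (of_real K * sin z + \<i> * of_nat n - \<i> * of_real K * w' / (of_int c * (w z)\<^sup>2))) (at z within S)"
        unfolding h_def using wz cd(2)
        by (auto intro!: derivative_eq_intros dw simp: field_simps power2_eq_square)
      have "(G has_field_derivative (exp (h z) * (of_real K * sin z + \<i> * of_nat n - \<i> * of_real K * w' / (of_int c * (w z)\<^sup>2)) * w z ^ (2 * n)
        - exp (h z) * (of_nat (2 * n) * w z ^ (2 * n - 1) * w')) / (w z ^ (2 * n) * w z ^ (2 * n))) (at z within S)"
        unfolding G_def using wz
        by (auto intro!: derivative_eq_intros dw dh)
      moreover have "(exp (h z) * (of_real K * sin z + \<i> * of_nat n - \<i> * of_real K * w' / (of_int c * (w z)\<^sup>2)) * w z ^ (2 * n)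
        - exp (h z) * (of_nat (2 * n) * w z ^ (2 * n - 1) * w')) / (w z ^ (2 * n) * w z ^ (2 * n)) = G' z"
      proof -
        have pw: "w z ^ (2 * n) = w z ^ (2 * n - 1) * w z"
          using n by (subst power_Suc2[symmetric]) simp
        have "\<i> * of_real K * w' / (of_int c * (w z)\<^sup>2) = - (of_real K * (\<i> * exp (\<i> * z)) / (w z)\<^sup>2)"
          unfolding w'_def using cd(2) by (simp add: field_simps)
        moreover have "(E * X * (P * v) - E * (N * P * v')) / (P * v * (P * v)) = E / (P * v) * (X - N * v' / v)"
          if "P \<noteq> 0" "v \<noteq> 0" for E X P v N v' :: complex
          using that by (simp add: field_simps)
        ultimately show ?thesis
          unfolding G'_def G_def w'_def[symmetric] pw using wz by simp
      qed
      ultimately show ?thesis by simp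
    qed
    show "norm (G' z) \<le> (4 * real n + K) * (4 * B)" if "z \<in> S" for z
    proof -
      from that obtain u where u: "z = of_real u" "0 \<le> u" "u \<le> 1 / 8" by (auto simp: S_def)
      have w2: "(norm (w z))\<^sup>2 \<ge> 7 / 4" using w_sq' u by simp
      have 1: "norm (of_real K * sin z) \<le> K / 8"
        using sin_cos_bounds[OF u(2,3)] K mult_left_mono[of "sin u" "1 / 8" K]
        by (simp add: u norm_mult sin_of_real)
      have 2: "norm (of_real K * (\<i> * exp (\<i> * z)) / (w z)\<^sup>2) \<le> K * (4 / 7)"
      proof -
        have "norm (of_real K * (\<i> * exp (\<i> * z)) / (w z)\<^sup>2) = K / (norm (w z))\<^sup>2"
          using K by (simp add: norm_divide norm_mult norm_power u)
        also have "\<dots> \<le> K / (7 / 4)"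
          using w2 K by (intro divide_left_mono) auto
        finally show ?thesis by simp
      qed
      \<comment> \<open>The denominator is compared with its imaginary part
        \<open>c * cos u\<close>, because the lower bound in terms of \<open>|c d|\<close> would
        leave a factor growing with \<open>|c / d|\<close>.\<close>
      have 3: "norm (2 * of_nat n * (of_int c * (\<i> * (\<i> * exp (\<i> * z)))) / w z) \<le> 2 * n * (1 / (99 / 100))"
      proof -
        have "\<bar>of_int c\<bar> * (99 / 100) \<le> \<bar>of_int c\<bar> * cos u"
          using sin_cos_bounds(3)[OF u(2,3)] by (intro mult_left_mono) auto
        also have "\<dots> = \<bar>Im (w z)\<bar>"
          using sin_cos_bounds(3)[OF u(2,3)] by (simp add: u w_arc abs_mult)
        also have "\<dots> \<le> norm (w z)" by (rule abs_Im_le_cmod)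
        finally have "\<bar>of_int c\<bar> / norm (w z) \<le> 1 / (99 / 100)"
          using w2 w_nz[OF u(2,3)] u(1) by (simp add: field_simps)
        then have "2 * n * (\<bar>of_int c\<bar> / norm (w z)) \<le> 2 * n * (1 / (99 / 100))"
          by (intro mult_left_mono) auto
        then show ?thesis by (simp add: norm_divide norm_mult u)
      qed
      have "norm (of_real K * sin z + \<i> * of_nat n + of_real K * (\<i> * exp (\<i> * z)) / (w z)\<^sup>2
        - 2 * of_nat n * (of_int c * (\<i> * (\<i> * exp (\<i> * z)))) / w z) \<le> K / 8 + n + K * (4 / 7) + 2 * n * (1 / (99 / 100))"
        using 1 2 3 by (intro norm_triangle_le_diff norm_triangle_le add_mono order_trans[OF norm_triangle_ineq4] order_trans[OF norm_triangle_ineq]) (auto simp: norm_mult)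
      \<comment> \<open>Here \<open>1 / 8 + 4 / 7 < 1\<close> and
        \<open>1 + 200 / 99 < 4\<close>.\<close>
      also have "\<dots> \<le> 4 * real n + K" using K by (simp add: field_simps)
      finally show ?thesis
        unfolding G'_def norm_mult using G_bound[OF u(2,3)] u(1) K
        by (subst mult.commute) (intro mult_mono, auto)
    qed
  qed
  then have "norm C * norm (G (of_real t) - G (of_real s)) \<le> norm C * (((4 * real n + K) * (4 * B)) * \<bar>t - s\<bar>)"
    by (intro mult_left_mono) (auto simp flip: of_real_diff)
  then show "norm (arc_term n m t (c, d) - arc_term n m s (c, d)) \<le> (4 * real n + K) * B * \<bar>t - s\<bar>"
    unfolding term_eq[OF t] term_eq[OF s] right_diff_distrib[symmetric] norm_mult by (simp add: normC)
qed

section \<open>Summation of the termwise bounds\<close>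

definition inner_pairs :: "(int \<times> int) set" where
  "inner_pairs = {(c, d). coprime c d \<and> c \<noteq> 0 \<and> d \<noteq> 0}"

definition arc_remainder :: "nat \<Rightarrow> int \<Rightarrow> real \<Rightarrow> complex" where
  "arc_remainder n m t = infsum (arc_term n m t) inner_pairs"

text \<open>The factor 3 is \<open>12 * (1 / 4)\<close>, with 12 from the lattice sum and
  \<open>1 / 4\<close> from the termwise bound. The exponential is
  \<open>exp (- 21 / 50 * K)\<close> for \<open>K = - 2 * pi * m\<close>.\<close>

definition remainder_bound :: "nat \<Rightarrow> int \<Rightarrow> real" where
  "remainder_bound n m = 3 * (4 / 7) ^ n * exp (21 / 25 * (pi * of_int m))"

text \<open>The sum over all pairs of nonzero integers is \<open>(pi^2 / 3)^2\<close>, which lies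
  below 12.\<close>

lemma inner_pairs_majorant:
  fixes C :: real
  assumes C: "C \<ge> 0"
  obtains S where "((\<lambda>(c, d). C / ((of_int c)\<^sup>2 * (of_int d)\<^sup>2)) has_sum S) inner_pairs" "S \<le> 12 * C"
proof -
  let ?g = "\<lambda>(c::int, d::int). 1 / ((of_int c)\<^sup>2 * (of_int d)\<^sup>2) :: real"
  let ?P = "(- {0::int}) \<times> (- {0::int})"
  have sub: "inner_pairs \<subseteq> ?P" by (auto simp: inner_pairs_def)
  have P: "(?g has_sum (pi\<^sup>2 / 3)\<^sup>2) ?P" by (rule has_sum_inverse_squares_nonzero_int_pairs)
  then have "?g summable_on inner_pairs"
    using has_sum_imp_summable sub summable_on_subset by blast
  then obtain S where S: "(?g has_sum S) inner_pairs" by (auto simp: summable_on_def)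
  have "S \<le> (pi\<^sup>2 / 3)\<^sup>2"
    by (rule has_sum_mono2[OF S P sub]) auto
  also have "pi \<le> 3.1415926535899" by (rule pi_approx)
  then have "(pi\<^sup>2 / 3)\<^sup>2 \<le> (3.1415926535899\<^sup>2 / 3)\<^sup>2"
    by (intro power_mono divide_right_mono) auto
  also have "\<dots> \<le> 12" by (simp add: power2_eq_square)
  finally have "S \<le> 12" .
  moreover have "((\<lambda>p. C * ?g p) has_sum (C * S)) inner_pairs"
    by (rule has_sum_cmult_right[OF S])
  then have "((\<lambda>(c, d). C / ((of_int c)\<^sup>2 * (of_int d)\<^sup>2)) has_sum (C * S)) inner_pairs"
    by (simp add: case_prod_unfold)
  ultimately show thesis
    using C by (intro that[of "C * S"]) (auto simp: mult.commute[of _ C] intro: mult_left_mono)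
qed

subsection \<open>Poincare series on the unit arc\<close>

context
  fixes n :: nat and m :: int
  assumes n: "n \<ge> 2" and m: "m < 0"
begin

lemma
  assumes t: "0 \<le> t" "t \<le> 1 / 8"
  shows arc_term_summable_inner: "arc_term n m t summable_on inner_pairs"
    and norm_arc_remainder_le: "norm (arc_remainder n m t) \<le> remainder_bound n m"
proof -
  define C :: real where "C = 1 / 4 * (4 / 7) ^ n * exp (21 / 25 * (pi * of_int m))"
  have "C \<ge> 0" by (simp add: C_def)
  then obtain S where S: "((\<lambda>(c, d). C / ((of_int c)\<^sup>2 * (of_int d)\<^sup>2)) has_sum S) inner_pairs" "S \<le> 12 * C"
    using inner_pairs_majorant by blast
  have le: "norm (arc_term n m t p) \<le> (\<lambda>(c, d). C / ((of_int c)\<^sup>2 * (of_int d)\<^sup>2)) p" if "p \<in> inner_pairs" for p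
    using that arc_term_bounds(1)[OF n m _ _ _ t t] by (auto simp: inner_pairs_def C_def)
  have "(\<lambda>p. norm (arc_term n m t p)) summable_on inner_pairs"
  proof (rule summable_on_comparison_test)
    show "(\<lambda>(c, d). C / ((of_int c)\<^sup>2 * (of_int d)\<^sup>2)) summable_on inner_pairs"
      using S by (auto simp: summable_on_def)
  qed (use le in auto)
  then show sum: "arc_term n m t summable_on inner_pairs"
    by (rule abs_summable_summable)
  have "norm (arc_remainder n m t) \<le> S"
    unfolding arc_remainder_def using le
    by (intro norm_infsum_le[OF has_sum_infsum[OF sum] S(1)])
  then show "norm (arc_remainder n m t) \<le> remainder_bound n m"
    using S(2) by (simp add: C_def remainder_bound_def)
qed

lemma arc_remainder_Lipschitz:
  assumes t: "0 \<le> t" "t \<le> 1 / 8" and s: "0 \<le> s" "s \<le> 1 / 8"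
  shows "norm (arc_remainder n m t - arc_remainder n m s)
    \<le> (4 * real n - 2 * pi * of_int m) * remainder_bound n m * \<bar>t - s\<bar>"
proof -
  define C :: real where "C = (4 * real n - 2 * pi * of_int m) * (1 / 4 * (4 / 7) ^ n * exp (21 / 25 * (pi * of_int m))) * \<bar>t - s\<bar>"
  have "- 2 * pi * of_int m \<ge> 0" using m by (simp add: mult_nonneg_nonpos)
  then have "C \<ge> 0" unfolding C_def by (intro mult_nonneg_nonneg) auto
  then obtain S where S: "((\<lambda>(c, d). C / ((of_int c)\<^sup>2 * (of_int d)\<^sup>2)) has_sum S) inner_pairs" "S \<le> 12 * C"
    using inner_pairs_majorant by blast
  have le: "norm (arc_term n m t p - arc_term n m s p) \<le> (\<lambda>(c, d). C / ((of_int c)\<^sup>2 * (of_int d)\<^sup>2)) p"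
    if "p \<in> inner_pairs" for p
    using that arc_term_bounds(2)[OF n m _ _ _ t s] by (auto simp: inner_pairs_def C_def mult_ac)
  have "((\<lambda>p. arc_term n m t p - arc_term n m s p) has_sum (arc_remainder n m t - arc_remainder n m s)) inner_pairs"
    unfolding arc_remainder_def
    using has_sum_add[OF has_sum_infsum[OF arc_term_summable_inner[OF t]]
        has_sum_uminusI[OF has_sum_infsum[OF arc_term_summable_inner[OF s]]]]
    by simp
  then have "norm (arc_remainder n m t - arc_remainder n m s) \<le> S"
    using le by (rule norm_infsum_le[OF _ S(1)])
  then show ?thesis
    using S(2) by (simp add: C_def remainder_bound_def mult_ac)
qed

text \<open>On the unit circle conjugation is \<open>z \<mapsto> 1 / z\<close>. It turns the matrix
  with rows \<open>(a, b)\<close>, \<open>(c, d)\<close> into the one with rows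
  \<open>(- b, - a)\<close>, \<open>(d, c)\<close>, and the power of \<open>z\<close> that appears
  is absorbed by the normalisation.\<close>

lemma cnj_arc_term:
  assumes t: "0 \<le> t" "t \<le> 1 / 8" and cd: "coprime c d"
  shows "cnj (arc_term n m t (c, d)) = arc_term n m t (d, c)"
proof -
  obtain a b where det: "a * d - b * c = 1" using coprime_imp_det_one cd by blast
  let ?u = "unit_arc t"
  have U: "?u \<in> upper_half_plane" by (rule unit_arc_in_upper_half_plane[OF t])
  have det': "(- b) * c - (- a) * d = 1" using det by simp
  have cnj_frac: "of_int x * cnj ?u + of_int y = (of_int x + of_int y * ?u) / ?u" for x y
    by (simp add: cnj_unit_arc field_simps)
  have frac: "(of_int a * cnj ?u + of_int b) / (of_int c * cnj ?u + of_int d)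
     = (of_int a + of_int b * ?u) / (of_int c + of_int d * ?u)"
    by (simp add: cnj_frac)
  have den: "(of_int c * cnj ?u + of_int d) ^ (2 * n) = (of_int c + of_int d * ?u) ^ (2 * n) / ?u ^ (2 * n)"
    by (simp add: cnj_frac power_divide)
  have "cnj (poincare_term (2 * n) m ?u (c, d)) = ?u ^ (2 * n) * poincare_term (2 * n) m ?u (d, c)"
    unfolding poincare_term_eq[OF det U] poincare_term_eq[OF det' U] complex_cnj_divide exp_cnj
      complex_cnj_mult complex_cnj_add complex_cnj_power complex_cnj_of_int complex_cnj_complex_of_real
      complex_cnj_i complex_cnj_numeral frac den
    by (simp add: add.commute divide_inverse) (simp add: algebra_simps)
  then show ?thesis
    by (simp add: arc_term_def cnj_unit_arc power_mult power2_eq_square power_mult_distrib power_divide exp_cnj)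
qed

text \<open>Conjugation only permutes the summands, by swapping \<open>c\<close> and
  \<open>d\<close>.\<close>

lemma arc_remainder_real:
  assumes t: "0 \<le> t" "t \<le> 1 / 8"
  shows "arc_remainder n m t = of_real (Re (arc_remainder n m t))"
proof -
  have bij: "bij_betw prod.swap inner_pairs inner_pairs"
    by (rule bij_betw_byWitness[where f' = prod.swap]) (auto simp: inner_pairs_def coprime_commute)
  have "cnj (arc_remainder n m t) = infsum (\<lambda>p. cnj (arc_term n m t p)) inner_pairs"
    by (simp add: arc_remainder_def)
  also have "\<dots> = infsum (\<lambda>p. arc_term n m t (prod.swap p)) inner_pairs"
    by (rule infsum_cong) (auto simp: inner_pairs_def cnj_arc_term[OF t])
  also have "\<dots> = arc_remainder n m t"
    unfolding arc_remainder_def by (rule infsum_reindex_bij_betw[OF bij])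
  finally show ?thesis
    by (metis complex_is_Real_iff Reals_cnj_iff of_real_Re)
qed

text \<open>The point \<open>\<i>\<close> is fixed by \<open>z \<mapsto> - 1 / z\<close>, so passing
  from \<open>(c, d)\<close> to \<open>(d, - c)\<close> multiplies a summand by
  \<open>\<i> ^ (2 * n) = - 1\<close>. This matters because for odd \<open>n\<close> the main term
  vanishes at \<open>t = 0\<close> too, and near that point the remainder must be small relative to
  \<open>t\<close>.\<close>

lemma arc_remainder_odd_0:
  assumes "odd n"
  shows "arc_remainder n m 0 = 0"
proof -
  have neg: "arc_term n m 0 (d, - c) = - arc_term n m 0 (c, d)" if cd: "coprime c d" for c d
  proof -
    obtain a b where det: "a * d - b * c = 1" using coprime_imp_det_one cd by blast
    have I: "\<i> \<in> upper_half_plane" by (simp add: upper_half_plane_def)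
    have det': "b * (- c) - (- a) * d = 1" using det by simp
    have eq: "of_int b * \<i> + of_int (- a) = \<i> * (of_int a * \<i> + of_int b)"
       "of_int d * \<i> + of_int (- c) = \<i> * (of_int c * \<i> + of_int d)"
      by (simp_all add: algebra_simps)
    have "\<i> ^ (2 * n) = -1" using assms by (simp add: power_mult)
    then have "poincare_term (2 * n) m \<i> (d, - c) = - poincare_term (2 * n) m \<i> (c, d)"
      unfolding poincare_term_eq[OF det I] poincare_term_eq[OF det' I] eq power_mult_distrib
      by simp
    then show ?thesis by (simp add: arc_term_def unit_arc_def)
  qed
  have bij: "bij_betw (\<lambda>(c, d). (d, - c)) inner_pairs inner_pairs"
    by (rule bij_betw_byWitness[where f' = "\<lambda>(c, d). (- d, c)"]) (auto simp: inner_pairs_def coprime_commute)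
  have "arc_remainder n m 0 = infsum (\<lambda>p. arc_term n m 0 ((\<lambda>(c, d). (d, - c)) p)) inner_pairs"
    unfolding arc_remainder_def by (rule infsum_reindex_bij_betw[OF bij, symmetric])
  also have "\<dots> = infsum (\<lambda>p. - arc_term n m 0 p) inner_pairs"
    by (rule infsum_cong) (auto simp: inner_pairs_def neg)
  also have "\<dots> = - arc_remainder n m 0"
    by (simp add: arc_remainder_def infsum_uminus)
  finally show ?thesis by simp
qed

text \<open>The pairs \<open>(0, 1)\<close> and \<open>(0, -1)\<close> each contribute a quarter of
  \<open>cis\<close> of the phase, and by the swap symmetry \<open>(1, 0)\<close> and
  \<open>(-1, 0)\<close> contribute the conjugates; together they form the cosine.\<close>

lemma poincare_series_unit_arc:
  fixes t :: real
  assumes t: "0 \<le> t" "t \<le> 1 / 8"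
  shows "exp (of_real (2 * pi * of_int m * cos t)) / 2 * unit_arc t ^ n * poincare_series (2 * n) (unit_arc t) m
    = of_real (cos (n * (pi / 2) + n * t - 2 * pi * of_int m * sin t)) + arc_remainder n m t"
proof -
  let ?u = "unit_arc t"
  let ?\<phi> = "n * (pi / 2) + n * t - 2 * pi * of_int m * sin t"
  have U: "?u \<in> upper_half_plane" by (rule unit_arc_in_upper_half_plane[OF t])
  define A :: "(int \<times> int) set" where "A = {(0, 1), (0, -1), (1, 0), (-1, 0 :: int)}"
  have split: "{(c, d). coprime c d} = A \<union> inner_pairs" "A \<inter> inner_pairs = {}" "finite A"
    by (auto simp: A_def inner_pairs_def)
  have pow: "?u ^ n = exp (\<i> * of_real (n * (pi / 2) + n * t))"
    unfolding cis_unit_arc[symmetric] Complex.DeMoivre by (simp add: cis_conv_exp algebra_simps)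
  have u: "?u = Complex (- sin t) (cos t)" by (simp add: complex_eq_iff)
  have "exp (of_real (2 * pi * of_int m * cos t)) * ?u ^ n * exp (2 * of_real pi * \<i> * of_int m * ?u) = cis ?\<phi>"
    unfolding pow cis_conv_exp exp_add[symmetric]
    by (rule arg_cong[of _ _ exp]) (simp add: complex_eq_iff u algebra_simps)
  then have term0: "arc_term n m t (0, 1) = cis ?\<phi> / 4" "arc_term n m t (0, -1) = cis ?\<phi> / 4"
    using poincare_term_eq[of 1 1 0 0 ?u "2 * n" m] poincare_term_eq[of "-1" "-1" 0 0 ?u "2 * n" m] U
    by (simp_all add: arc_term_def)
  have term1: "arc_term n m t (1, 0) = cis (- ?\<phi>) / 4" "arc_term n m t (-1, 0) = cis (- ?\<phi>) / 4"
    using cnj_arc_term[OF t, of 0 1] cnj_arc_term[OF t, of 0 "-1"] unfolding term0 cis_cnj[symmetric]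
    by simp_all
  have "exp (of_real (2 * pi * of_int m * cos t)) / 2 * ?u ^ n * poincare_series (2 * n) ?u m
    = infsum (arc_term n m t) (A \<union> inner_pairs)"
    unfolding poincare_series_altdef arc_term_def[abs_def] infsum_cmult_right' split(1)[symmetric] by simp
  also have "\<dots> = infsum (arc_term n m t) A + arc_remainder n m t"
    unfolding arc_remainder_def using split
    by (intro infsum_Un_disjoint summable_on_finite arc_term_summable_inner t)
  also have "infsum (arc_term n m t) A = (cis ?\<phi> + cis (- ?\<phi>)) / 2"
    by (simp add: A_def term0 term1)
  also have "(cis x + cis (- x)) / 2 = of_real (cos x)" for x
    by (simp add: complex_eq_iff)
  finally show ?thesis .
qed

end

subsection \<open>First zeros\<close>

lemma sin_ge_cubic:
  fixes x :: real
  assumes "0 \<le> x"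
  shows "x - x ^ 3 / 6 \<le> sin x"
proof -
  have "\<bar>sin x - x\<bar> \<le> \<bar>x\<bar> ^ 3 / 6"
    using Maclaurin_sin_bound[of x 3] by (simp add: eval_nat_numeral sin_coeff_def)
  then have "\<bar>sin x - x\<bar> \<le> x ^ 3 / 6" using assms by simp
  then show ?thesis by linarith
qed

lemma sin_gt_half:
  fixes x :: real
  assumes "0 < x" "x \<le> pi / 2"
  shows "x / 2 < sin x"
proof -
  have "x - x ^ 3 / 6 \<le> sin x"
    using assms by (intro sin_ge_cubic) simp
  moreover have "x ^ 3 / 6 < x / 2"
  proof -
    have "pi / 2 < 8 / 5" using pi_approx by simp
    then have "x * x < 8 / 5 * (8 / 5)" using assms by (intro mult_strict_mono) auto
    then have "x * (x * x) < x * 3" using assms by (intro mult_strict_left_mono) auto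
    then show ?thesis by (simp add: power3_eq_cube)
  qed
  ultimately show ?thesis by linarith
qed

text \<open>The phase at which the main term has its first zero with \<open>t > 0\<close>.\<close>

definition first_phase :: "nat \<Rightarrow> real" where
  "first_phase n = (if even n then pi / 2 else pi)"

text \<open>Up to sign, both parities become a sine vanishing at \<open>first_phase n\<close>, so
  sign changes can be treated uniformly.\<close>

lemma cos_shift_first_phase:
  obtains \<sigma> :: real where "\<bar>\<sigma>\<bar> = 1" "\<And>x. cos (n * (pi / 2) + x) = \<sigma> * sin (first_phase n - x)"
proof (cases "even n")
  case True
  then obtain j where j: "n = 2 * j" by blast
  have "cos (n * (pi / 2) + x) = (-1) ^ j * sin (first_phase n - x)" for x
    by (simp add: j first_phase_def cos_add sin_diff mult.commute[of _ pi])
  then show thesis by (intro that[of "(-1) ^ j"]) (simp_all add: power_abs)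
next
  case False
  then obtain j where j: "n = 2 * j + 1" by (metis oddE)
  have "n * (pi / 2) + x = (j * pi + x) + pi / 2" for x
    by (simp add: j field_simps)
  then have "cos (n * (pi / 2) + x) = - sin (j * pi + x)" for x
    by (simp only: cos_add) simp
  then have "cos (n * (pi / 2) + x) = - ((-1) ^ j) * sin (first_phase n - x)" for x
    using False by (simp add: first_phase_def sin_add sin_diff)
  then show thesis by (intro that[of "- ((-1) ^ j)"]) (simp_all add: power_abs)
qed

section \<open>Zeros of a perturbed cosine\<close>

text \<open>Only these properties of the series are used to study its zeros: \<open>K\<close> is
  \<open>- 2 * pi * m\<close>, \<open>r n\<close> is the remainder for weight \<open>2 * n\<close>,
  and \<open>E n\<close> bounds it. Smallness of \<open>E n * (n + K)\<close> serves twice: it makes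
  the Lipschitz constant at most 1, and it makes \<open>E n\<close> small compared with
  \<open>t\<close> at the zeros considered.\<close>

locale arc_functions =
  fixes K :: real and E :: "nat \<Rightarrow> real" and r :: "nat \<Rightarrow> real \<Rightarrow> real"
  assumes K_ge: "K \<ge> 6" and frac_K: "6 / 100 \<le> frac K" "frac K \<le> 99 / 100"
    and E_pos: "\<And>n. n \<ge> 25 \<Longrightarrow> 0 < E n"
    and E_small: "\<And>n. n \<ge> 25 \<Longrightarrow> E n * (n + K) \<le> 3 / 2000"
    and r_bound: "\<And>n t. n \<ge> 25 \<Longrightarrow> 0 \<le> t \<Longrightarrow> t \<le> 1 / 8 \<Longrightarrow> \<bar>r n t\<bar> \<le> E n"
    and r_Lipschitz: "\<And>n t s. n \<ge> 25 \<Longrightarrow> 0 \<le> t \<Longrightarrow> t \<le> 1 / 8 \<Longrightarrow> 0 \<le> s \<Longrightarrow> s \<le> 1 / 8 \<Longrightarrow>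
      \<bar>r n t - r n s\<bar> \<le> (4 * real n + K) * E n * \<bar>t - s\<bar>"
    and r_odd_0: "\<And>n. n \<ge> 25 \<Longrightarrow> odd n \<Longrightarrow> r n 0 = 0"
begin

definition phase :: "nat \<Rightarrow> real \<Rightarrow> real" where
  "phase n t = n * t + K * sin t"

definition H :: "nat \<Rightarrow> real \<Rightarrow> real" where
  "H n t = cos (n * (pi / 2) + phase n t) + r n t"

lemma phase_0 [simp]: "phase n 0 = 0"
  by (simp add: phase_def)

lemma phase_mono:
  assumes "0 \<le> s" "s \<le> t" "t \<le> 1 / 8"
  shows "phase n s \<le> phase n t"
proof -
  have "sin s \<le> sin t" using assms pi_gt3 by (intro sin_monotone_2pi_le) linarith+
  then show ?thesis
    unfolding phase_def using assms K_ge by (intro add_mono mult_left_mono) auto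
qed

lemma E_le: "n \<ge> 25 \<Longrightarrow> E n \<le> 1 / 10000"
proof -
  assume n: "n \<ge> 25"
  have "E n * 31 \<le> E n * (n + K)"
    using E_pos[OF n] K_ge n by (intro mult_left_mono) auto
  then show ?thesis using E_small[OF n] by linarith
qed

lemma first_phase_bounds: "3 / 2 \<le> first_phase n" "first_phase n \<le> 3142 / 1000"
  using pi_approx by (auto simp: first_phase_def)

text \<open>At phase \<open>first_phase n\<close> minus or plus \<open>2 * E n\<close> the main term
  has modulus \<open>sin (2 * E n) > E n\<close> and opposite signs. The remainder cannot change
  these signs, so the intermediate value theorem gives a zero in between.\<close>

lemma H_zero_exists:
  assumes n: "n \<ge> 25"
  obtains t where "0 < t" "t \<le> 1 / 8" "\<bar>phase n t - first_phase n\<bar> \<le> 2 * E n" "H n t = 0"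
proof -
  let ?\<tau> = "first_phase n" and ?\<eta> = "2 * E n"
  obtain \<sigma> :: real where \<sigma>: "\<bar>\<sigma>\<bar> = 1"
    and cos: "\<And>x. cos (n * (pi / 2) + x) = \<sigma> * sin (?\<tau> - x)"
    using cos_shift_first_phase[of n] by blast
  have \<sigma>2: "\<sigma> * \<sigma> = 1" using \<sigma> by (metis abs_mult_self_eq mult_1)
  note E = E_pos[OF n] E_le[OF n]
  \<comment> \<open>The value \<open>25 / 8 + 6 / 16 = 3.5\<close> exceeds
    \<open>pi + 2 * E n\<close>, so both phases are reached by \<open>t = 1 / 8\<close>.\<close>
  have "phase n (1 / 8) \<ge> 25 * (1 / 8) + 6 * (1 / 16)"
    unfolding phase_def using n K_ge sin_gt_half[of "1 / 8"] pi_gt3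
    by (intro add_mono mult_mono) auto
  then have end_phase: "phase n (1 / 8) \<ge> ?\<tau> + ?\<eta>" using first_phase_bounds(2)[of n] E by linarith
  have cont_phase: "continuous_on A (phase n)" for A
    unfolding phase_def by (intro continuous_intros)
  obtain u where u: "0 \<le> u" "u \<le> 1 / 8" "phase n u = ?\<tau> - ?\<eta>"
    using IVT'[of "phase n" 0 "?\<tau> - ?\<eta>" "1 / 8"] end_phase first_phase_bounds(1)[of n] E cont_phase
    by auto
  then have "u \<noteq> 0" using first_phase_bounds(1)[of n] E by auto
  obtain v where v: "u \<le> v" "v \<le> 1 / 8" "phase n v = ?\<tau> + ?\<eta>"
    using IVT'[of "phase n" u "?\<tau> + ?\<eta>" "1 / 8"] end_phase u E cont_phase by auto
  have "E n < sin ?\<eta>"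
    using sin_gt_half[of ?\<eta>] E pi_gt3 by simp
  moreover have "\<bar>\<sigma> * r n u\<bar> \<le> E n" "\<bar>\<sigma> * r n v\<bar> \<le> E n"
    using r_bound[OF n, of u] r_bound[OF n, of v] u v \<sigma> by (simp_all add: abs_mult)
  moreover have "\<sigma> * H n u = sin ?\<eta> + \<sigma> * r n u" "\<sigma> * H n v = - sin ?\<eta> + \<sigma> * r n v"
    unfolding H_def cos u(3) v(3) distrib_left mult.assoc[symmetric] \<sigma>2 by simp_all
  ultimately have sign: "\<sigma> * H n u \<ge> 0" "\<sigma> * H n v \<le> 0" by linarith+
  have "continuous_on {0..1/8} (r n)"
  proof -
    have "(4 * real n + K) * E n \<ge> 0" using K_ge E by simp
    then have "((4 * real n + K) * E n)-lipschitz_on {0..1/8} (r n)"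
      using r_Lipschitz[OF n] by (intro lipschitz_onI) (auto simp: dist_real_def)
    then show ?thesis by (rule lipschitz_on_continuous_on)
  qed
  then have "continuous_on {0..1/8} (\<lambda>t. \<sigma> * H n t)"
    unfolding H_def phase_def by (intro continuous_intros)
  then have "continuous_on {u..v} (\<lambda>t. \<sigma> * H n t)"
    using u v by (rule_tac continuous_on_subset) auto
  then obtain t where t: "u \<le> t" "t \<le> v" "\<sigma> * H n t = 0"
    using IVT2'[of "\<lambda>t. \<sigma> * H n t" v 0 u] sign v by auto
  show thesis
  proof (rule that)
    show "0 < t" "t \<le> 1 / 8" using u t v \<open>u \<noteq> 0\<close> by auto
    show "H n t = 0" using t \<sigma> by auto
    show "\<bar>phase n t - first_phase n\<bar> \<le> 2 * E n"
      using phase_mono[of u t n] phase_mono[of t v n] u v t by auto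
  qed
qed

text \<open>Let \<open>y\<close> be the distance of the phase to \<open>first_phase n\<close>. If
  \<open>y \<le> pi / 2\<close>, then \<open>sin y > y / 2 > E n\<close> beats the remainder.
  Otherwise the phase is close to 0, where the sine exceeds \<open>25 * t / 2\<close> while the
  remainder is at most \<open>t\<close>.\<close>

lemma H_nonzero_before_first_phase:
  assumes n: "n \<ge> 25" and t: "0 < t" "t \<le> 1 / 8" and before: "phase n t < first_phase n - 2 * E n"
  shows "H n t \<noteq> 0"
proof -
  define y where "y = first_phase n - phase n t"
  obtain \<sigma> :: real where \<sigma>: "\<bar>\<sigma>\<bar> = 1"
    and cos: "\<And>x. cos (n * (pi / 2) + x) = \<sigma> * sin (first_phase n - x)"
    using cos_shift_first_phase[of n] by blast
  note E = E_pos[OF n]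
  have sin_t: "0 \<le> sin t" using t pi_gt3 by (intro sin_ge_zero) linarith+
  have nt: "n * t \<le> phase n t" using K_ge sin_t by (simp add: phase_def)
  have t_nt: "25 * t \<le> n * t" using n t by (intro mult_right_mono) auto
  have phase_pos: "0 < phase n t" using nt t_nt t by linarith
  have "\<bar>r n t\<bar> < \<bar>sin y\<bar>"
  proof (cases "y \<le> pi / 2")
    case True
    have "y / 2 < sin y" using before E True by (intro sin_gt_half) (auto simp: y_def)
    moreover have "E n < y / 2" using before by (simp add: y_def)
    ultimately show ?thesis using r_bound[OF n, of t] t by linarith
  next
    case False
    \<comment> \<open>The phase is positive, so \<open>y > pi / 2\<close> excludes
      \<open>first_phase n = pi / 2\<close>.\<close>
    then have odd: "odd n" and phase_le: "phase n t \<le> pi / 2"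
      using phase_pos by (auto simp: y_def first_phase_def split: if_splits)
    have "(4 * real n + K) * E n \<le> 4 * (E n * (n + K))"
      using K_ge E by (simp add: algebra_simps)
    also have "\<dots> \<le> 1" using E_small[OF n] by linarith
    finally have "(4 * real n + K) * E n * t \<le> 1 * t" using t by (intro mult_right_mono) linarith+
    then have "\<bar>r n t\<bar> \<le> t"
      using r_Lipschitz[OF n, of t 0] r_odd_0[OF n odd] t by (auto intro: order_trans)
    moreover have "phase n t / 2 < sin (phase n t)"
      using phase_le phase_pos by (intro sin_gt_half)
    moreover have "sin y = sin (phase n t)"
      using odd by (simp add: y_def first_phase_def)
    ultimately show ?thesis using nt t_nt t by linarith
  qed
  moreover have "\<bar>\<sigma> * sin y\<bar> = \<bar>sin y\<bar>" using \<sigma> by (simp add: abs_mult)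
  ultimately show ?thesis unfolding H_def cos y_def[symmetric] by linarith
qed

text \<open>The phase is at least 1 there and at most \<open>(n + K) * t\<close>, hence
  \<open>t \<ge> 1 / (n + K)\<close>. The absolute error \<open>2 * E n\<close> thus becomes an
  error relative to \<open>t\<close>.\<close>

lemma close_to_first_phase_imp:
  assumes n: "n \<ge> 25" and t: "0 < t" "t \<le> 1 / 8" and close: "\<bar>phase n t - first_phase n\<bar> \<le> 2 * E n"
  shows "2 * E n \<le> 3 / 1000 * t"
proof -
  have "1 \<le> phase n t" using close first_phase_bounds(1)[of n] E_le[OF n] by linarith
  also have "\<dots> \<le> (n + K) * t"
    using sin_x_le_x[of t] t K_ge by (simp add: phase_def algebra_simps)
  finally have "2 * E n * 1 \<le> 2 * E n * ((n + K) * t)"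
    using E_pos[OF n] by (intro mult_left_mono) auto
  also have "\<dots> = 2 * (E n * (n + K)) * t" by simp
  also have "\<dots> \<le> 2 * (3 / 2000) * t"
    using E_small[OF n] t by (intro mult_right_mono) auto
  finally show ?thesis by simp
qed

text \<open>Both phases would lie within \<open>3 / 1000 * t\<close> of the same number, yet they
  differ by \<open>(n' - n) * t \<ge> t\<close>.\<close>

lemma first_phases_same_parity_separated:
  assumes "n \<ge> 25" "n' \<ge> 25" "n < n'" "even n \<longleftrightarrow> even n'" and t: "0 < t" "t \<le> 1 / 8"
    and close: "\<bar>phase n t - first_phase n\<bar> \<le> 2 * E n" "\<bar>phase n' t - first_phase n'\<bar> \<le> 2 * E n'"
  shows False
proof -
  have "first_phase n = first_phase n'" using assms(4) by (simp add: first_phase_def)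
  then have "phase n' t - phase n t \<le> 6 / 1000 * t"
    using close close_to_first_phase_imp[OF assms(1) t close(1)] close_to_first_phase_imp[OF assms(2) t close(2)]
    by linarith
  moreover have "phase n' t - phase n t = (real n' - real n) * t"
    by (simp add: phase_def algebra_simps)
  moreover have "(real n' - real n) * t \<ge> 1 * t" using assms(3) t by (intro mult_right_mono) auto
  ultimately show False using t by linarith
qed

text \<open>In \<open>phase b t - 2 * phase a t\<close> the targets \<open>pi\<close> and
  \<open>2 * (pi / 2)\<close> cancel, which leaves \<open>(b - 2 a) * t - K * sin t\<close> with an
  error of \<open>3 * (3 / 1000) * t\<close>. As \<open>sin t\<close> is close to \<open>t\<close>,
  the integer \<open>b - 2 a\<close> would be too close to \<open>K\<close>.\<close>

lemma first_phases_opposite_parity_separated: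
  assumes a: "a \<ge> 25" "even a" and b: "b \<ge> 25" "odd b" and t: "0 < t" "t \<le> 1 / 8"
    and close: "\<bar>phase a t - first_phase a\<bar> \<le> 2 * E a" "\<bar>phase b t - first_phase b\<bar> \<le> 2 * E b"
  shows False
proof -
  define j :: int where "j = int b - 2 * int a"
  have fa: "first_phase a = pi / 2" and fb: "first_phase b = pi" using a b by (simp_all add: first_phase_def)
  have eq: "phase b t - 2 * phase a t = real_of_int j * t - K * sin t"
    by (simp add: phase_def j_def algebra_simps)
  have jt: "\<bar>real_of_int j * t - K * sin t\<bar> \<le> 9 / 1000 * t"
    unfolding eq[symmetric]
    using close close_to_first_phase_imp[OF a(1) t close(1)] close_to_first_phase_imp[OF b(1) t close(2)]
    unfolding fa fb by linarith
  have upper: "K * sin t \<le> K * t"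
    using sin_x_le_x[of t] t K_ge by (intro mult_left_mono) auto
  \<comment> \<open>The summands \<open>a * t\<close> and \<open>K * sin t\<close> are nonnegative
    with sum at most 1.6, so each is at most 1.6.\<close>
  have "K * t / 2 \<le> K * sin t" using sin_gt_half[of t] t pi_gt3 K_ge mult_left_mono[of "t / 2" "sin t" K] by simp
  moreover have "25 * t \<le> a * t" using a t by (intro mult_right_mono) auto
  moreover have "a * t + K * sin t \<le> 16 / 10"
    using close(1) E_le[OF a(1)] pi_approx unfolding fa phase_def by simp
  ultimately have Kt: "K * t \<le> 32 / 10" and t_le: "t \<le> 64 / 1000"
    using t mult_nonneg_nonneg[of K t] K_ge by linarith+
  have "K * (t ^ 3 / 6) = (K * t) * t * (t / 6)" by (simp add: power3_eq_cube)
  also have "\<dots> \<le> 32 / 10 * (64 / 1000) * (t / 6)"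
    using Kt t_le t K_ge by (intro mult_mono) auto
  also have "\<dots> \<le> 35 / 1000 * t" using t by simp
  finally have "K * (t ^ 3 / 6) \<le> 35 / 1000 * t" .
  moreover have "K * (t - t ^ 3 / 6) \<le> K * sin t"
    using sin_ge_cubic[of t] t K_ge by (intro mult_left_mono) auto
  ultimately have "K * t - 35 / 1000 * t \<le> K * sin t" by (simp add: right_diff_distrib)
  then have "real_of_int j * t \<le> (K + 9 / 1000) * t" "(K - 44 / 1000) * t \<le> real_of_int j * t"
    using jt upper unfolding distrib_right left_diff_distrib by linarith+
  then have "real_of_int j \<le> K + 9 / 1000" "K - 44 / 1000 \<le> real_of_int j"
    using t by (simp_all add: mult_le_cancel_right_pos)
  \<comment> \<open>The bounds on \<open>frac K\<close> enter here:
    \<open>44 / 1000 < 6 / 100\<close> and \<open>9 / 1000 < 1 - 99 / 100\<close>.\<close>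
  then have "real_of_int j < real_of_int (\<lfloor>K\<rfloor> + 1)" "real_of_int \<lfloor>K\<rfloor> < real_of_int j"
    using frac_K unfolding frac_def by simp_all
  then show False unfolding of_int_less_iff by linarith
qed

text \<open>Take the least of the chosen zeros. If another \<open>H n'\<close> vanished there, its
  phase could not be below \<open>first_phase n' - 2 * E n'\<close>, nor above
  \<open>first_phase n' + 2 * E n'\<close> by monotonicity and minimality. Two indices would then be
  near their first phases at the same \<open>t\<close>, which the separation lemmas exclude.\<close>

lemma exists_unshared_zero:
  assumes N: "finite N" "N \<noteq> {}" "\<And>n. n \<in> N \<Longrightarrow> n \<ge> 25"
  obtains n t where "n \<in> N" "0 \<le> t" "t \<le> 1 / 8" "H n t = 0" "\<And>n'. n' \<in> N \<Longrightarrow> n' \<noteq> n \<Longrightarrow> H n' t \<noteq> 0"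
proof -
  have "\<forall>n\<in>N. \<exists>t. 0 < t \<and> t \<le> 1 / 8 \<and> \<bar>phase n t - first_phase n\<bar> \<le> 2 * E n \<and> H n t = 0"
    using N(3) H_zero_exists by metis
  then obtain \<zeta> where \<zeta>: "\<And>n. n \<in> N \<Longrightarrow> 0 < \<zeta> n" "\<And>n. n \<in> N \<Longrightarrow> \<zeta> n \<le> 1 / 8"
    "\<And>n. n \<in> N \<Longrightarrow> \<bar>phase n (\<zeta> n) - first_phase n\<bar> \<le> 2 * E n" "\<And>n. n \<in> N \<Longrightarrow> H n (\<zeta> n) = 0"
    by metis
  obtain n where n: "n \<in> N" "\<And>n'. n' \<in> N \<Longrightarrow> \<zeta> n \<le> \<zeta> n'"
    using arg_min_least[OF N(1,2), of _ \<zeta>] arg_min_if_finite(1)[OF N(1,2), of \<zeta>] by blast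
  have "H n' (\<zeta> n) \<noteq> 0" if n': "n' \<in> N" "n' \<noteq> n" for n'
  proof
    assume "H n' (\<zeta> n) = 0"
    then have "phase n' (\<zeta> n) \<ge> first_phase n' - 2 * E n'"
      using H_nonzero_before_first_phase N(3) \<zeta> n n' by (meson not_le)
    moreover have "phase n' (\<zeta> n) \<le> phase n' (\<zeta> n')"
      using \<zeta> n n' by (intro phase_mono) (auto intro: less_imp_le)
    ultimately have close': "\<bar>phase n' (\<zeta> n) - first_phase n'\<bar> \<le> 2 * E n'"
      using \<zeta>(3)[OF n'(1)] by linarith
    note 25 = N(3)[OF n(1)] N(3)[OF n'(1)]
    note t = \<zeta>(1,2)[OF n(1)] and close = \<zeta>(3)[OF n(1)]
    show False
      using first_phases_same_parity_separated[OF 25 _ _ t close close']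
        first_phases_same_parity_separated[OF 25(2,1) _ _ t close' close]
        first_phases_opposite_parity_separated[OF 25(1) _ 25(2) _ t close close']
        first_phases_opposite_parity_separated[OF 25(2) _ 25(1) _ t close' close] n'(2)
      by (metis nat_neq_iff)
  qed
  then show thesis using that[of n "\<zeta> n"] n \<zeta> by (simp add: less_imp_le)
qed

end

section \<open>Numerical estimates and the conclusion\<close>

lemma mult_power_four_sevenths_le:
  assumes "n \<ge> 25"
  shows "real n * (4 / 7) ^ n \<le> 3 / 100000"
  using assms
proof (induction n rule: dec_induct)
  case base
  then show ?case by (simp add: power_divide divide_simps)
next
  case (step n)
  have "real (Suc n) * (4 / 7) ^ Suc n = (real (Suc n) * (4 / 7)) * (4 / 7) ^ n" by simp
  also have "\<dots> \<le> real n * (4 / 7) ^ n" using step by (intro mult_right_mono) auto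
  finally show ?case using step by linarith
qed

text \<open>From \<open>(n - 1) * (K - 1) \<ge> 1\<close> follows \<open>n + K \<le> n * K\<close>,
  which separates the variables. The factor in \<open>n\<close> is at most
  \<open>3 / 100000\<close>, and \<open>exp x \<ge> 1 + x\<close> bounds the factor in
  \<open>K\<close> by 3.\<close>

lemma remainder_bound_small:
  fixes K :: real
  assumes n: "n \<ge> 25" and K: "K \<ge> 6"
  shows "3 * (4 / 7) ^ n * exp (- (21 / 50 * K)) * (n + K) \<le> 3 / 2000"
proof -
  have "0 \<le> (real n - 1) * (K - 1) - 1"
    using mult_mono[of 1 "real n - 1" 1 "K - 1"] n K by simp
  then have "n + K \<le> n * K" by (simp add: algebra_simps)
  then have "3 * (4 / 7) ^ n * exp (- (21 / 50 * K)) * (n + K)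
    \<le> 3 * (4 / 7) ^ n * exp (- (21 / 50 * K)) * (n * K)"
    by (intro mult_left_mono) auto
  also have "\<dots> = 3 * (n * (4 / 7) ^ n) * (K * exp (- (21 / 50 * K)))" by simp
  also have "\<dots> \<le> 3 * (3 / 100000) * 3"
  proof (intro mult_mono mult_left_mono mult_power_four_sevenths_le n)
    have "K \<le> 3 * exp (21 / 50 * K)"
      using exp_ge_add_one_self[of "21 / 50 * K"] K by linarith
    then show "K * exp (- (21 / 50 * K)) \<le> 3"
      by (simp add: exp_minus field_simps)
  qed (use K in auto)
  finally show ?thesis by simp
qed

theorem theorem1:
  fixes s t :: nat and m :: int and k l :: "nat \<Rightarrow> nat"
  assumes "s \<ge> 1" and "t \<ge> 1"
    and "m < 0"
    and "0.06 \<le> frac (- 2 * of_int m * pi)" and "frac (- 2 * of_int m * pi) \<le> 0.99"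
    and "\<And>i. i \<in> {1..s} \<Longrightarrow> even (k i) \<and> k i \<ge> 50"
    and "\<And>j. j \<in> {1..t} \<Longrightarrow> even (l j) \<and> l j \<ge> 50"
    and "\<And>i j. i \<in> {1..s} \<Longrightarrow> j \<in> {1..t} \<Longrightarrow> k i \<noteq> l j"
  shows "\<not> (\<forall>z\<in>upper_half_plane.
    (\<Prod>i=1..s. poincare_series (k i) z m) = (\<Prod>j=1..t. poincare_series (l j) z m))"
proof
  assume eq: "\<forall>z\<in>upper_half_plane.
    (\<Prod>i=1..s. poincare_series (k i) z m) = (\<Prod>j=1..t. poincare_series (l j) z m)"
  define K :: real where "K = - 2 * of_int m * pi"
  have "1 * 6 \<le> (- real_of_int m) * (2 * pi)"
    using \<open>m < 0\<close> pi_gt3 by (intro mult_mono) auto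
  then have K: "K \<ge> 6" by (simp add: K_def mult_ac)
  have frac: "6 / 100 \<le> frac K" "frac K \<le> 99 / 100"
    using assms(4,5) by (simp_all add: K_def power2_eq_square)
  have bound_eq: "remainder_bound n m = 3 * (4 / 7) ^ n * exp (- (21 / 50 * K))" for n
    by (simp add: remainder_bound_def K_def mult_ac)
  define r where "r = (\<lambda>n u. Re (arc_remainder n m u))"
  interpret arc_functions K "\<lambda>n. remainder_bound n m" r
  proof
    show "K \<ge> 6" "6 / 100 \<le> frac K" "frac K \<le> 99 / 100" by (fact K frac)+
    show "0 < remainder_bound n m" for n by (simp add: remainder_bound_def)
    show "remainder_bound n m * (n + K) \<le> 3 / 2000" if "n \<ge> 25" for n
      unfolding bound_eq by (rule remainder_bound_small[OF that K])
    show "\<bar>r n u\<bar> \<le> remainder_bound n m" if "n \<ge> 25" "0 \<le> u" "u \<le> 1 / 8" for n u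
      unfolding r_def using norm_arc_remainder_le[of n m u] \<open>m < 0\<close> that
      by (intro order_trans[OF abs_Re_le_cmod]) auto
    show "\<bar>r n u - r n v\<bar> \<le> (4 * real n + K) * remainder_bound n m * \<bar>u - v\<bar>"
      if "n \<ge> 25" "0 \<le> u" "u \<le> 1 / 8" "0 \<le> v" "v \<le> 1 / 8" for n u v
    proof -
      have "\<bar>r n u - r n v\<bar> \<le> norm (arc_remainder n m u - arc_remainder n m v)"
        unfolding r_def minus_complex.sel(1)[symmetric] by (rule abs_Re_le_cmod)
      also have "\<dots> \<le> (4 * real n - 2 * pi * of_int m) * remainder_bound n m * \<bar>u - v\<bar>"
        using that \<open>m < 0\<close> by (intro arc_remainder_Lipschitz) auto
      finally show ?thesis by (simp add: K_def mult_ac)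
    qed
    show "r n 0 = 0" if "n \<ge> 25" "odd n" for n
      using that \<open>m < 0\<close> by (simp add: r_def arc_remainder_odd_0)
  qed
  \<comment> \<open>The normalising factor never vanishes, so the zeros on the arc are those of
    \<open>H\<close> at half the weight.\<close>
  have zero_iff: "poincare_series w (unit_arc u) m = 0 \<longleftrightarrow> H (w div 2) u = 0"
    if w: "even w" "w \<ge> 50" and u: "0 \<le> u" "u \<le> 1 / 8" for w u
  proof -
    have "w div 2 \<ge> 2" using w by simp
    note rem = poincare_series_unit_arc[OF this \<open>m < 0\<close> u] arc_remainder_real[OF this \<open>m < 0\<close> u]
    have H_eq: "H (w div 2) u = cos ((w div 2) * (pi / 2) + (w div 2) * u - 2 * pi * of_int m * sin u)
      + Re (arc_remainder (w div 2) m u)"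
      unfolding H_def phase_def by (simp add: r_def K_def add_diff_eq mult_ac)
    have "exp (of_real (2 * pi * of_int m * cos u)) / 2 * unit_arc u ^ (w div 2) * poincare_series w (unit_arc u) m
      = of_real (H (w div 2) u)"
      using rem(1) unfolding dvd_mult_div_cancel[OF w(1)]
      unfolding H_eq by (subst (asm) rem(2)) simp
    moreover have "exp (of_real (2 * pi * of_int m * cos u)) / 2 * unit_arc u ^ (w div 2) \<noteq> 0"
      by simp
    ultimately show ?thesis by (metis mult_eq_0_iff of_real_eq_0_iff)
  qed
  define N where "N = (\<lambda>i. k i div 2) ` {1..s} \<union> (\<lambda>j. l j div 2) ` {1..t}"
  have N: "finite N" "N \<noteq> {}" "\<And>n. n \<in> N \<Longrightarrow> n \<ge> 25"
    using assms(1,6,7) by (fastforce simp: N_def)+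
  obtain n u where n: "n \<in> N" and u: "0 \<le> u" "u \<le> 1 / 8" and Hn: "H n u = 0"
    and others: "\<And>n'. n' \<in> N \<Longrightarrow> n' \<noteq> n \<Longrightarrow> H n' u \<noteq> 0"
    using exists_unshared_zero[OF N] by metis
  \<comment> \<open>At the chosen point only the half weight \<open>n\<close> gives a zero, so a
    product vanishes exactly when \<open>n\<close> occurs among its factors.\<close>
  have prod_zero: "(\<Prod>i\<in>S. poincare_series (w i) (unit_arc u) m) = 0 \<longleftrightarrow> n \<in> (\<lambda>i. w i div 2) ` S"
    if S: "finite S" "(\<lambda>i. w i div 2) ` S \<subseteq> N" "\<And>i. i \<in> S \<Longrightarrow> even (w i) \<and> w i \<ge> 50" for w :: "nat \<Rightarrow> nat" and S
  proof -
    have "poincare_series (w i) (unit_arc u) m = 0 \<longleftrightarrow> w i div 2 = n" if "i \<in> S" for i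
    proof -
      have "w i div 2 \<in> N" using S(2) that by blast
      then have "H (w i div 2) u = 0 \<longleftrightarrow> w i div 2 = n" using Hn others by blast
      then show ?thesis using zero_iff[OF _ _ u] S(3)[OF that] by simp
    qed
    then show ?thesis using S(1) by (auto simp: image_iff)
  qed
  have left: "(\<Prod>i=1..s. poincare_series (k i) (unit_arc u) m) = 0 \<longleftrightarrow> n \<in> (\<lambda>i. k i div 2) ` {1..s}"
    using assms(6) by (intro prod_zero) (auto simp: N_def)
  have right: "(\<Prod>j=1..t. poincare_series (l j) (unit_arc u) m) = 0 \<longleftrightarrow> n \<in> (\<lambda>j. l j div 2) ` {1..t}"
    using assms(7) by (intro prod_zero) (auto simp: N_def)
  \<comment> \<open>Equality at this single point puts \<open>n\<close> on both sides, and even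
    weights with equal halves coincide.\<close>
  have "n \<in> (\<lambda>i. k i div 2) ` {1..s} \<longleftrightarrow> n \<in> (\<lambda>j. l j div 2) ` {1..t}"
    using eq unit_arc_in_upper_half_plane[OF u] left right by metis
  then obtain i j where "i \<in> {1..s}" "j \<in> {1..t}" "k i div 2 = l j div 2"
    using n by (auto simp: N_def)
  then show False using assms(6-8) by (metis dvd_mult_div_cancel)
qed

end
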